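(* Let $\sigma\in\mathcal S_{0,\infty}$ be given and let the growth condition (defined in the context) hold for $\sigma$. The following statements are equivalent: (i) There exist $M\ge1$ and $\rho\in(0,1)$ such that $\|U_\sigma(t,s)\|\le M\rho^{\kappa_\sigma(t,s)}$ for all $t\ge s\ge0$. (ii) There exist $p\ge1$ and $b>0$ such that $$\sum_{k\ge1,\ t_k>s}\|U_\sigma(t_k^-,s)x\|^p\le b^p\|x\|^p$$ for all $s\ge0$ and all $x\in X$. (iii) There exist a functional $V:\mathbb R_{\ge0}\times X\to\mathbb R_{\ge0}$, Lipschitz on bounded subsets of $X$ uniformly in $t$ and piecewise right-continuous in $t$ (see context), and constants $p\ge1$, $c>0$ such that for all $x\in X$ $$V(t,x)\le c\|x\|^p\quad\forall t\ge0,\qquad \underline D^+V(t,x)\le0\quad\forall t\ge0,\qquad V(t,Jx)-V(t^-,x)\le-\|x\|^p\quad\forall t\in\mathbb T_\sigma.$$ Moreover, when (i) holds, an explicit functional witnessing (iii) is $$V(t,x):=\sum_{k\ge1:\ t_k>t}\|U_\sigma(t_k^-,t)x\|^p.$$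
   Context: Setting. $X$ is a Banach space with norm $\|\cdot\|$; $A:D(A)\subset X\to X$ generates a strongly continuous ($C_0$) semigroup $(S(t))_{t\ge0}$ on $X$; $J\in L(X)$ is bounded, $J\neq0$, $JD(A)\subset D(A)$. $\mathcal S_{0,\infty}$ is the set of sequences $\sigma=\{t_k\}_{k\ge1}$ with, setting $t_0:=0$, $t_{k+1}>t_k$ for all $k\ge0$ and $t_k\to\infty$; $\mathbb T_\sigma:=\{t_k:k\ge1\}$. The impulsive system is $\dot x(t)=Ax(t)$ for $t\notin\mathbb T_\sigma$, $x(t)=Jx(t^-)$ for $t\in\mathbb T_\sigma$. Its propagator $U_\sigma(t,s)$, $t\ge s\ge0$, is: $U_\sigma(t,s)=S(t-s)$ if $(s,t]\cap\mathbb T_\sigma=\varnothing$; otherwise, if $t_l<\dots<t_m$ are the impulse times in $(s,t]$, $U_\sigma(t,s)=S(t-t_m)JS(t_m-t_{m-1})J\cdots JS(t_l-s)$. For $s<t_k$, $U_\sigma(t_k^-,s)x:=\lim_{t\uparrow t_k}U_\sigma(t,s)x$. $\kappa_\sigma(t,s):=\#(\mathbb T_\sigma\cap(s,t])$. Growth condition for $\sigma$: there exist a piecewise continuous $g:\mathbb R_{\ge0}\to\mathbb R_{>0}$ bounded below by some $c_0>0$, and $\mu>1$, such that $\|U_\sigma(t,s)x\|\le g(t-s)\mu^{\kappa_\sigma(t,s)}\|x\|$ for all $t\ge s\ge0$, $x\in X$, and $G:=\sup_{0\le\tau<\bar T}g(\tau)<\infty$, where $\bar T:=\sup_{k\ge0}(t_{k+1}-t_k)\in(0,\infty]$.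 Functionals. $V$ is Lipschitz on bounded subsets of $X$ uniformly in $t$ if for every $r>0$ there is $L_r>0$ with $|V(t,x)-V(t,y)|\le L_r\|x-y\|$ for all $\|x\|<r$, $\|y\|<r$, $t\ge0$. Piecewise right-continuous in $t$ means: for each $x$, $t\mapsto V(t,x)$ is continuous on each $[t_k,t_{k+1})$, $k\ge0$, and has left limits $V(t_k^-,x):=\lim_{t\uparrow t_k}V(t,x)$ at impulse times. The lower right-hand Dini derivative along the flow is $$\underline D^+V(t,x):=\liminf_{h\downarrow0}\frac{V(t+h,S(h)x)-V(t,x)}{h}.$$ *)

theory Defs
  imports "HOL-Analysis.Analysis"
begin

text \<open>
  A family of operators on the nonnegative reals is a function \<open>S :: real \<Rightarrow> 'a \<Rightarrow>\<^sub>L 'a\<close>, of which only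
  the values at nonnegative arguments matter.
\<close>

definition C0_semigroup :: "(real \<Rightarrow> 'a \<Rightarrow>\<^sub>L 'a::real_normed_vector) \<Rightarrow> bool" where
  "C0_semigroup S \<longleftrightarrow>
     S 0 = id_blinfun \<and>
     (\<forall>s\<ge>0. \<forall>t\<ge>0. S (s + t) = S s o\<^sub>L S t) \<and>
     (\<forall>x. ((\<lambda>t. S t x) \<longlongrightarrow> x) (at_right 0))"

text \<open>The values of \<open>A\<close> outside the domain \<open>D\<close> are irrelevant.\<close>

definition generates ::
    "'a set \<Rightarrow> ('a \<Rightarrow> 'a) \<Rightarrow> (real \<Rightarrow> 'a \<Rightarrow>\<^sub>L 'a::real_normed_vector) \<Rightarrow> bool" where
  "generates D A S \<longleftrightarrow>
     C0_semigroup S \<and>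
     D = {x. \<exists>y. ((\<lambda>h. (S h x - x) /\<^sub>R h) \<longlongrightarrow> y) (at_right 0)} \<and>
     (\<forall>x\<in>D. ((\<lambda>h. (S h x - x) /\<^sub>R h) \<longlongrightarrow> A x) (at_right 0))"

text \<open>
  An impulse sequence \<open>\<sigma>\<close> carries the convention \<open>t\<^sub>0 = 0\<close> as \<open>\<sigma> 0 = 0\<close>; the impulse times are the
  \<open>\<sigma> k\<close> with \<open>k \<ge> 1\<close>.
\<close>

definition impulse_sequence :: "(nat \<Rightarrow> real) \<Rightarrow> bool" where
  "impulse_sequence \<sigma> \<longleftrightarrow>
     \<sigma> 0 = 0 \<and> (\<forall>k. \<sigma> k < \<sigma> (Suc k)) \<and> filterlim \<sigma> at_top sequentially"

definition impulse_times :: "(nat \<Rightarrow> real) \<Rightarrow> real set" where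
  "impulse_times \<sigma> = {\<sigma> k |k. k \<ge> 1}"

text \<open>
  \<open>jump_flow S J t s [\<tau>\<^sub>l, \<dots>, \<tau>\<^sub>m]\<close> is \<open>S (t - \<tau>\<^sub>m) J S (\<tau>\<^sub>m - \<tau>\<^bsub>m-1\<^esub>) J \<dots> J S (\<tau>\<^sub>l - s)\<close>.
  For an impulse sequence only finitely many impulse times lie in \<open>(s, t]\<close>, so that
  \<open>sorted_list_of_set\<close> and \<open>card\<close> below are never applied to infinite sets.
\<close>

fun jump_flow ::
    "(real \<Rightarrow> 'a \<Rightarrow>\<^sub>L 'a::real_normed_vector) \<Rightarrow> ('a \<Rightarrow>\<^sub>L 'a) \<Rightarrow> real \<Rightarrow> real \<Rightarrow> real list \<Rightarrow> 'a \<Rightarrow>\<^sub>L 'a" where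
  "jump_flow S J t s [] = S (t - s)"
| "jump_flow S J t s (\<tau> # \<tau>s) = jump_flow S J t \<tau> \<tau>s o\<^sub>L (J o\<^sub>L S (\<tau> - s))"

definition propagator ::
    "(real \<Rightarrow> 'a \<Rightarrow>\<^sub>L 'a::real_normed_vector) \<Rightarrow> ('a \<Rightarrow>\<^sub>L 'a) \<Rightarrow> (nat \<Rightarrow> real) \<Rightarrow> real \<Rightarrow> real \<Rightarrow> 'a \<Rightarrow>\<^sub>L 'a"
  where
  "propagator S J \<sigma> t s = jump_flow S J t s (sorted_list_of_set (impulse_times \<sigma> \<inter> {s<..t}))"

definition propagator_left ::
    "(real \<Rightarrow> 'a \<Rightarrow>\<^sub>L 'a::real_normed_vector) \<Rightarrow> ('a \<Rightarrow>\<^sub>L 'a) \<Rightarrow> (nat \<Rightarrow> real) \<Rightarrow> real \<Rightarrow> real \<Rightarrow> 'a \<Rightarrow> 'a"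
  where
  "propagator_left S J \<sigma> \<tau> s x = Lim (at_left \<tau>) (\<lambda>t. propagator S J \<sigma> t s x)"

definition impulse_count :: "(nat \<Rightarrow> real) \<Rightarrow> real \<Rightarrow> real \<Rightarrow> nat" where
  "impulse_count \<sigma> t s = card (impulse_times \<sigma> \<inter> {s<..t})"

text \<open>
  Piecewise continuity on \<open>[0, \<infinity>)\<close>: finitely many discontinuities in each bounded interval, and
  finite one-sided limits everywhere.
\<close>

definition piecewise_continuous :: "(real \<Rightarrow> real) \<Rightarrow> bool" where
  "piecewise_continuous g \<longleftrightarrow>
     (\<forall>R. finite {\<tau> \<in> {0..R}. \<not> continuous (at \<tau> within {0..}) g}) \<and>
     (\<forall>\<tau>\<ge>0. \<exists>l. (g \<longlongrightarrow> l) (at_right \<tau>)) \<and>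
     (\<forall>\<tau>>0. \<exists>l. (g \<longlongrightarrow> l) (at_left \<tau>))"

definition max_dwell_time :: "(nat \<Rightarrow> real) \<Rightarrow> ereal" where
  "max_dwell_time \<sigma> = (SUP k. ereal (\<sigma> (Suc k) - \<sigma> k))"

definition growth_condition ::
    "(real \<Rightarrow> 'a \<Rightarrow>\<^sub>L 'a::real_normed_vector) \<Rightarrow> ('a \<Rightarrow>\<^sub>L 'a) \<Rightarrow> (nat \<Rightarrow> real) \<Rightarrow> bool" where
  "growth_condition S J \<sigma> \<longleftrightarrow>
     (\<exists>g c\<^sub>0 \<mu>.
        piecewise_continuous g \<and> c\<^sub>0 > 0 \<and> (\<forall>\<tau>\<ge>0. g \<tau> \<ge> c\<^sub>0) \<and> \<mu> > 1 \<and>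
        (\<forall>s t x. 0 \<le> s \<and> s \<le> t \<longrightarrow>
           norm (propagator S J \<sigma> t s x) \<le> g (t - s) * \<mu> ^ impulse_count \<sigma> t s * norm x) \<and>
        (SUP \<tau>\<in>{\<tau>. 0 \<le> \<tau> \<and> ereal \<tau> < max_dwell_time \<sigma>}. ereal (g \<tau>)) < \<infinity>)"

definition lipschitz_on_bounded_sets :: "(real \<Rightarrow> 'a::real_normed_vector \<Rightarrow> real) \<Rightarrow> bool" where
  "lipschitz_on_bounded_sets V \<longleftrightarrow>
     (\<forall>r>0. \<exists>L>0. \<forall>x y t. norm x < r \<and> norm y < r \<and> t \<ge> 0 \<longrightarrow>
        \<bar>V t x - V t y\<bar> \<le> L * norm (x - y))"

definition piecewise_right_continuous ::
    "(nat \<Rightarrow> real) \<Rightarrow> (real \<Rightarrow> 'a \<Rightarrow> real) \<Rightarrow> bool" where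
  "piecewise_right_continuous \<sigma> V \<longleftrightarrow>
     (\<forall>x. (\<forall>k. continuous_on {\<sigma> k..<\<sigma> (Suc k)} (\<lambda>t. V t x)) \<and>
          (\<forall>\<tau>\<in>impulse_times \<sigma>. \<exists>l. ((\<lambda>t. V t x) \<longlongrightarrow> l) (at_left \<tau>)))"

definition dini_derivative ::
    "(real \<Rightarrow> 'a \<Rightarrow>\<^sub>L 'a::real_normed_vector) \<Rightarrow> (real \<Rightarrow> 'a \<Rightarrow> real) \<Rightarrow> real \<Rightarrow> 'a \<Rightarrow> ereal" where
  "dini_derivative S V t x =
     Liminf (at_right 0) (\<lambda>h. ereal ((V (t + h) (S h x) - V t x) / h))"

definition lyapunov_functional ::
    "(real \<Rightarrow> 'a \<Rightarrow>\<^sub>L 'a::real_normed_vector) \<Rightarrow> ('a \<Rightarrow>\<^sub>L 'a) \<Rightarrow> (nat \<Rightarrow> real)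
      \<Rightarrow> (real \<Rightarrow> 'a \<Rightarrow> real) \<Rightarrow> real \<Rightarrow> real \<Rightarrow> bool" where
  "lyapunov_functional S J \<sigma> V p c \<longleftrightarrow>
     (\<forall>t\<ge>0. \<forall>x. V t x \<ge> 0) \<and>
     lipschitz_on_bounded_sets V \<and>
     piecewise_right_continuous \<sigma> V \<and>
     (\<forall>x. (\<forall>t\<ge>0. V t x \<le> c * norm x powr p) \<and>
          (\<forall>t\<ge>0. dini_derivative S V t x \<le> 0) \<and>
          (\<forall>t\<in>impulse_times \<sigma>. V t (J x) - Lim (at_left t) (\<lambda>\<tau>. V \<tau> x) \<le> - (norm x powr p)))"

end

theory Submission
  imports Defs
begin

text \<open>
  Write \<open>s\<^sub>1\<close> for the first impulse time after \<open>s\<close> and \<open>y = S (s\<^sub>1 - s) x\<close> for the state just before it.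
  All three statements are about the same one-step inequality
  \<open>norm y powr p + V s\<^sub>1 (J y) \<le> V s x\<close> for a function \<open>0 \<le> V t x \<le> c * norm x powr p\<close>.

  The sum \<open>W\<close> of the powers \<open>norm (U (t\<^sub>k\<^sup>-, s) x) powr p\<close> satisfies it with equality, because splitting
  off the first summand leaves the sum that starts at \<open>s\<^sub>1\<close> in \<open>J y\<close> (\<open>jump_energy_step\<close>); (ii) says that
  \<open>W\<close> has the upper bound. A functional \<open>V\<close> as in (iii) satisfies it as well: its Dini derivative makes
  \<open>V\<close> nonincreasing along the flow up to \<open>s\<^sub>1\<close>, and the jump condition then takes off
  \<open>norm y powr p\<close> (\<open>lyapunov_functional_step\<close>).

  Conversely the inequality implies (i) (\<open>exponential_decay_if_lyapunov_step\<close>). The upper bound gives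
  \<open>V s\<^sub>1 (J y) \<le> B * norm y powr p\<close> with \<open>B = c * norm J powr p\<close>, so that the term
  \<open>norm y powr p\<close> in the inequality controls \<open>V s\<^sub>1 (J y)\<close>, and \<open>V\<close> shrinks by the factor
  \<open>B / (1 + B) < 1\<close> over each impulse. Since \<open>norm y powr p \<le> V s x\<close>, the states shrink with it; between
  impulses they grow at most by the factor \<open>G\<close> that the growth condition provides.

  From (i), finally, the summands of \<open>W\<close> decay geometrically, uniformly in the starting time, which gives
  summability, the upper bound, and the local Lipschitz estimate. Between two impulses
  \<open>W t x = norm (S (s\<^sub>1 - t) x) powr p + W s\<^sub>1 (J (S (s\<^sub>1 - t) x))\<close>, so continuity in \<open>t\<close> comes from the strong
  continuity of the semigroup, the left limit at \<open>s\<^sub>1\<close> is \<open>norm x powr p + W s\<^sub>1 (J x)\<close>, and \<open>W\<close> is constant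
  along the flow (\<open>jump_energy_lyapunov\<close>).
\<close>

section \<open>Preliminaries from real analysis\<close>

text \<open>
  Suppose \<open>v b > v a + e * (b - a)\<close> for some slope \<open>e > 0\<close>. At the last time at which
  \<open>v t - e * (t - a)\<close> does not exceed an intermediate level, all difference quotients of \<open>v\<close> to the right are
  at least \<open>e\<close>, hence so is their lower limit.
\<close>

lemma nonincreasing_if_lower_dini_nonpos:
  fixes v :: "real \<Rightarrow> real"
  assumes "a \<le> b" and cont: "continuous_on {a..b} v"
    and dini: "\<And>t. a \<le> t \<Longrightarrow> t < b \<Longrightarrow>
      Liminf (at_right 0) (\<lambda>h. ereal ((v (t + h) - v t) / h)) \<le> 0"
  shows "v b \<le> v a"
proof (rule field_le_epsilon)
  fix e' :: real assume "e' > 0"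
  \<comment> \<open>The summand 1 keeps the denominator positive when \<open>a = b\<close>.\<close>
  define e where "e = e' / (b - a + 1)"
  have e: "e > 0" "e * (b - a) \<le> e'"
    using \<open>e' > 0\<close> \<open>a \<le> b\<close> by (auto simp: e_def field_simps)
  define w where "w t = v t - e * (t - a)" for t
  have wcont: "continuous_on {a..b} w"
    unfolding w_def by (intro continuous_intros cont)
  have "w b \<le> w a"
  proof (rule ccontr)
    assume "\<not> w b \<le> w a"
    then obtain c where c: "w a < c" "c < w b" using dense by (meson not_le)
    \<comment> \<open>\<open>\<tau>\<close> is the last time at which \<open>w\<close> is at or below the level \<open>c\<close>.\<close>
    define Z where "Z = {t\<in>{a..b}. w t \<le> c}"
    define \<tau> where "\<tau> = Sup Z"
    have "closed Z"
      using continuous_closed_preimage[OF wcont, of "{..c}"] by (simp add: Z_def vimage_def Int_def)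
    have "a \<in> Z" using c \<open>a \<le> b\<close> by (auto simp: Z_def)
    have bdd: "bdd_above Z" by (auto simp: Z_def intro!: bdd_aboveI[of _ b])
    have "\<tau> \<in> Z"
      unfolding \<tau>_def using \<open>a \<in> Z\<close> bdd \<open>closed Z\<close> by (intro closed_contains_Sup) auto
    then have \<tau>: "a \<le> \<tau>" "\<tau> < b" "w \<tau> \<le> c"
      using c by (auto simp: Z_def less_le)
    have above: "w t > c" if "\<tau> < t" "t \<le> b" for t
    proof (rule ccontr)
      assume "\<not> w t > c"
      then have "t \<in> Z" using that \<tau> by (auto simp: Z_def)
      then show False using cSup_upper[OF _ bdd, of t] that by (simp add: \<tau>_def)
    qed
    have "eventually (\<lambda>h. 0 < h \<and> h < b - \<tau>) (at_right (0::real))"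
      using \<tau> by (intro eventually_at_rightI[of 0 "b - \<tau>"]) auto
    then have "eventually (\<lambda>h. ereal e \<le> ereal ((v (\<tau> + h) - v \<tau>) / h)) (at_right 0)"
    proof eventually_elim
      case (elim h)
      then have "w (\<tau> + h) > w \<tau>" using above[of "\<tau> + h"] \<tau> by auto
      then show ?case using elim by (auto simp: w_def field_simps)
    qed
    then have "ereal e \<le> Liminf (at_right 0) (\<lambda>h. ereal ((v (\<tau> + h) - v \<tau>) / h))"
      by (rule Liminf_bounded)
    also have "\<dots> \<le> 0" using dini \<tau> by auto
    finally show False using e by simp
  qed
  then show "v b \<le> v a + e'" using e by (simp add: w_def)
qed

text \<open>
  The mean value theorem for \<open>\<lambda>x. x powr p\<close>, whose derivative is increasing because \<open>p \<ge> 1\<close>.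
\<close>

lemma abs_diff_powr_le:
  fixes a b R p :: real
  assumes "p \<ge> 1" "0 \<le> a" "0 \<le> b" "a \<le> R" "b \<le> R"
  shows "\<bar>a powr p - b powr p\<bar> \<le> p * R powr (p - 1) * \<bar>a - b\<bar>"
proof -
  have ordered: "b powr p - a powr p \<le> p * R powr (p - 1) * (b - a)"
    if "0 \<le> a" "a < b" "b \<le> R" for a b
  proof -
    have "continuous_on {a..b} (\<lambda>x. x powr p)"
      using assms(1) that by (intro continuous_on_powr' continuous_intros) auto
    moreover have "((\<lambda>x. x powr p) has_real_derivative p * x powr (p - 1)) (at x)" if "a < x" for x
      using that \<open>0 \<le> a\<close> by (auto intro!: has_real_derivative_powr)
    ultimately obtain z where z: "a < z" "z < b"
      "b powr p - a powr p = (b - a) * (p * z powr (p - 1))"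
      using MVT[of a b "\<lambda>x. x powr p"] \<open>a < b\<close>
      by (metis DERIV_unique real_differentiable_def)
    have "z powr (p - 1) \<le> R powr (p - 1)"
      using z that assms(1) by (intro powr_mono2) auto
    then show ?thesis unfolding z(3) using assms(1) that
      by (simp add: mult.commute mult_left_mono)
  qed
  have mono: "x powr p \<le> y powr p" if "0 \<le> x" "x \<le> y" for x y :: real
    using that assms(1) by (intro powr_mono2) auto
  consider "a < b" | "b < a" | "a = b" by linarith
  then show ?thesis
    using ordered[of a b] ordered[of b a] mono[of a b] mono[of b a] assms
    by cases (auto simp: abs_if)
qed

lemma geometric_has_sum_shifted:
  fixes \<rho> :: real
  assumes "0 < \<rho>" "\<rho> < 1"
  shows "((\<lambda>k. \<rho> ^ (k - n)) has_sum 1 / (1 - \<rho>)) {n..}"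
proof -
  have "((\<lambda>j. \<rho> ^ j) has_sum 1 / (1 - \<rho>)) UNIV"
    using geometric_sums[of \<rho>] assms by (intro sums_nonneg_imp_has_sum) auto
  moreover have "bij_betw (\<lambda>j. j + n) UNIV {n..}"
    by (rule bij_betw_byWitness[of _ "\<lambda>k. k - n"]) auto
  ultimately show ?thesis
    using has_sum_reindex_bij_betw[of "\<lambda>j. j + n" UNIV "{n..}" "\<lambda>k. \<rho> ^ (k - n)"] by auto
qed

text \<open>
  Uniformity of the Lipschitz constant in time allows the time to move along with the state.
\<close>

lemma lipschitz_on_bounded_sets_continuous:
  fixes V :: "real \<Rightarrow> 'a::real_normed_vector \<Rightarrow> real"
  assumes V: "lipschitz_on_bounded_sets V"
    and y: "(y \<longlongrightarrow> l) F" and t: "eventually (\<lambda>i. t i \<ge> 0) F"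
  shows "((\<lambda>i. V (t i) (y i) - V (t i) l) \<longlongrightarrow> 0) F"
proof -
  define r where "r = norm l + 1"
  have "r > 0" by (simp add: r_def add_nonneg_pos)
  then obtain L where L: "L > 0"
    "\<And>x y t. norm x < r \<Longrightarrow> norm y < r \<Longrightarrow> t \<ge> 0 \<Longrightarrow> \<bar>V t x - V t y\<bar> \<le> L * norm (x - y)"
    using V unfolding lipschitz_on_bounded_sets_def by meson
  have "eventually (\<lambda>i. norm (y i) < r) F"
    using tendsto_norm[OF y] by (rule order_tendstoD) (simp add: r_def)
  then have ev: "eventually (\<lambda>i. norm (V (t i) (y i) - V (t i) l) \<le> norm (y i - l) * L) F"
    using t by eventually_elim (use L(2) in \<open>auto simp: r_def mult.commute\<close>)
  have "((\<lambda>i. y i - l) \<longlongrightarrow> 0) F" using y by (simp add: LIM_zero)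
  from tendsto_0_le[OF this ev] show ?thesis .
qed

section \<open>The semigroup between impulses\<close>

text \<open>
  Right continuity is the semigroup law applied to the limit at \<open>0\<close>. Left continuity at \<open>t\<close> follows from
  \<open>S (t - h) x - S t x = S (t - h) (x - S h x)\<close> and a bound for \<open>S (t - h)\<close>. The bound is only assumed on
  \<open>[0, d)\<close>, and yet the right end point \<open>d\<close> is reached: this is how the state just before an impulse is
  obtained.
\<close>

lemma C0_semigroup_strongly_continuous:
  fixes S :: "real \<Rightarrow> 'a \<Rightarrow>\<^sub>L 'a::real_normed_vector"
  assumes S: "C0_semigroup S"
    and G: "\<And>\<tau>. 0 \<le> \<tau> \<Longrightarrow> \<tau> < d \<Longrightarrow> norm (S \<tau>) \<le> G"
  shows "continuous_on {0..d} (\<lambda>\<tau>. S \<tau> x)"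
proof -
  have add: "S (s + t) y = S s (S t y)" if "s \<ge> 0" "t \<ge> 0" for s t y
    using S that by (simp add: C0_semigroup_def)
  have right0: "((\<lambda>h. S h x) \<longlongrightarrow> x) (at_right 0)"
    using S by (simp add: C0_semigroup_def)
  have right: "((\<lambda>\<tau>. S \<tau> x) \<longlongrightarrow> S t x) (at_right t)" if "t \<ge> 0" for t
  proof -
    have "((\<lambda>h. S t (S h x)) \<longlongrightarrow> S t x) (at_right 0)"
      by (intro tendsto_intros right0)
    moreover have "eventually (\<lambda>h::real. S t (S h x) = S (h + t) x) (at_right 0)"
      using that add[of t] by (intro eventually_at_rightI[of 0 1]) (auto simp: add.commute)
    ultimately have "((\<lambda>h. S (h + t) x) \<longlongrightarrow> S t x) (at_right 0)"
      by (rule Lim_transform_eventually)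
    then show ?thesis by (subst filterlim_at_right_to_0)
  qed
  have left: "((\<lambda>\<tau>. S \<tau> x) \<longlongrightarrow> S t x) (at_left t)" if "0 < t" "t \<le> d" for t
  proof -
    have "((\<lambda>h. S h x - x) \<longlongrightarrow> 0) (at_right 0)"
      using right0 by (simp add: LIM_zero)
    moreover have "eventually (\<lambda>h::real. 0 < h \<and> h < t) (at_right 0)"
      using that by (intro eventually_at_rightI[of 0 t]) auto
    then have "eventually (\<lambda>h. norm (S (t - h) x - S t x) \<le> norm (S h x - x) * G) (at_right 0)"
    proof eventually_elim
      case (elim h)
      have "S t x = S (t - h) (S h x)" using add[of "t - h" h x] elim by simp
      then have "norm (S (t - h) x - S t x) = norm (S (t - h) (x - S h x))"
        by (simp add: blinfun.diff_right)
      also have "\<dots> \<le> norm (S (t - h)) * norm (x - S h x)" by (rule norm_blinfun)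
      also have "\<dots> \<le> G * norm (x - S h x)"
        using elim that by (intro mult_right_mono G) auto
      finally show ?case by (simp add: norm_minus_commute mult.commute)
    qed
    ultimately have "((\<lambda>h. S (t - h) x - S t x) \<longlongrightarrow> 0) (at_right 0)"
      by (rule tendsto_0_le)
    then have "((\<lambda>h. S (t - h) x) \<longlongrightarrow> S t x) (at_right 0)"
      by (simp add: LIM_zero_iff)
    then show ?thesis
      by (simp add: filterlim_at_left_to_right filterlim_at_right_to_0[of _ _ "- t"])
  qed
  show ?thesis
  proof (cases "0 < d")
    case True
    then show ?thesis
      by (intro continuous_on_IccI) (simp_all add: filterlim_at_split right left)
  next
    case False
    then have "{0..d} = {} \<or> {0..d} = {0}" by auto
    then show ?thesis by auto
  qed
qed

section \<open>Trajectories of the impulsive system\<close>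

locale impulse_grid =
  fixes S :: "real \<Rightarrow> 'a \<Rightarrow>\<^sub>L 'a::real_normed_vector"
    and J :: "'a \<Rightarrow>\<^sub>L 'a"
    and \<sigma> :: "nat \<Rightarrow> real"
  assumes impulses: "impulse_sequence \<sigma>"
begin

abbreviation U :: "real \<Rightarrow> real \<Rightarrow> 'a \<Rightarrow>\<^sub>L 'a" where
  "U \<equiv> propagator S J \<sigma>"

abbreviation U_left :: "nat \<Rightarrow> real \<Rightarrow> 'a \<Rightarrow> 'a" where
  "U_left k s \<equiv> propagator_left S J \<sigma> (\<sigma> k) s"

abbreviation later :: "real \<Rightarrow> nat set" where
  "later s \<equiv> {k. k \<ge> 1 \<and> \<sigma> k > s}"

definition between :: "nat \<Rightarrow> real \<Rightarrow> bool" where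
  "between n s \<longleftrightarrow> \<sigma> n \<le> s \<and> s < \<sigma> (Suc n)"

lemma strict_mono_impulses: "strict_mono \<sigma>"
  using impulses by (simp add: impulse_sequence_def strict_mono_Suc_iff)

lemma impulse_less_iff [simp]: "\<sigma> i < \<sigma> j \<longleftrightarrow> i < j"
  using strict_mono_impulses by (rule strict_mono_less)

lemma impulse_le_iff [simp]: "\<sigma> i \<le> \<sigma> j \<longleftrightarrow> i \<le> j"
  using strict_mono_impulses by (rule strict_mono_less_eq)

lemma impulse_nonneg: "0 \<le> \<sigma> n"
  by (metis impulse_le_iff impulse_sequence_def impulses le0)

lemma between_impulse: "between n (\<sigma> n)"
  by (simp add: between_def)

lemma between_nonneg: "between n s \<Longrightarrow> 0 \<le> s"
  using impulse_nonneg[of n] by (simp add: between_def)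

lemma between_exists:
  assumes "0 \<le> s"
  obtains n where "between n s"
proof -
  have "filterlim \<sigma> at_top sequentially"
    using impulses by (simp add: impulse_sequence_def)
  then have "eventually (\<lambda>n. s < \<sigma> n) sequentially"
    by (simp add: filterlim_at_top_dense)
  then have ex: "\<exists>n. s < \<sigma> n" by (auto simp: eventually_sequentially)
  define N where "N = (LEAST n. s < \<sigma> n)"
  have "s < \<sigma> N" using ex unfolding N_def by (rule LeastI_ex)
  then have "N \<noteq> 0"
    using assms impulses by (metis impulse_sequence_def not_le)
  then obtain n where n: "N = Suc n" by (cases N) auto
  have "\<not> s < \<sigma> n"
    using not_less_Least[of n "\<lambda>n. s < \<sigma> n"] n by (simp add: N_def)
  then show ?thesis using that[of n] \<open>s < \<sigma> N\<close> n by (simp add: between_def)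
qed

lemma impulse_greater_iff:
  assumes "between n s"
  shows "s < \<sigma> k \<longleftrightarrow> n < k"
proof
  assume "s < \<sigma> k"
  then have "\<sigma> n < \<sigma> k" using assms by (simp add: between_def del: impulse_less_iff)
  then show "n < k" by simp
next
  assume "n < k"
  then have "\<sigma> (Suc n) \<le> \<sigma> k" by simp
  then show "s < \<sigma> k" using assms by (simp add: between_def del: impulse_le_iff)
qed

lemma later_eq: "between n s \<Longrightarrow> later s = {Suc n..}"
  by (auto simp: impulse_greater_iff)

lemma between_le_mono: "between n s \<Longrightarrow> between m t \<Longrightarrow> s \<le> t \<Longrightarrow> n \<le> m"
  using impulse_greater_iff[of n s "Suc m"] by (auto simp: between_def)

lemma impulse_times_Ioc:
  assumes "between n s" "between m t"
  shows "impulse_times \<sigma> \<inter> {s<..t} = \<sigma> ` {n<..m}"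
proof -
  have "\<sigma> k \<le> t \<longleftrightarrow> k \<le> m" for k
    using impulse_greater_iff[OF assms(2), of k] by linarith
  then show ?thesis
    using impulse_greater_iff[OF assms(1)] by (auto simp: impulse_times_def)
qed

lemma impulse_count_eq:
  assumes "between n s" "between m t"
  shows "impulse_count \<sigma> t s = m - n"
  using assms strict_mono_imp_inj_on[OF strict_mono_impulses]
  by (simp add: impulse_count_def impulse_times_Ioc card_image inj_on_subset)

lemma propagator_eq_jump_flow:
  assumes "between n s" "between m t"
  shows "U t s = jump_flow S J t s (map \<sigma> [Suc n..<Suc m])"
proof -
  let ?ts = "map \<sigma> [Suc n..<Suc m]"
  have "sorted ?ts"
    by (auto simp: sorted_iff_nth_mono simp del: upt_Suc)
  moreover have "distinct ?ts"
    by (simp add: distinct_map inj_on_subset[OF strict_mono_imp_inj_on[OF strict_mono_impulses] subset_UNIV]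
        del: upt_Suc)
  ultimately have "sorted_list_of_set (set ?ts) = ?ts"
    by (rule sorted_list_of_set.idem_if_sorted_distinct)
  moreover have "set ?ts = \<sigma> ` {n<..m}" by auto
  ultimately have "sorted_list_of_set (\<sigma> ` {n<..m}) = ?ts" by simp
  then show ?thesis using assms by (simp add: propagator_def impulse_times_Ioc)
qed

lemma propagator_before_impulse:
  assumes "between n s" "between n t"
  shows "U t s = S (t - s)"
  using assms by (simp add: propagator_eq_jump_flow)

text \<open>
  Trajectories are always unfolded at their first impulse. Every induction below moves the starting point
  \<open>(s, x)\<close> to the state right after that impulse and leaves the final time alone.
\<close>

lemma propagator_first_impulse:
  assumes "between n s" "\<sigma> (Suc n) \<le> t"
  shows "U t s x = U t (\<sigma> (Suc n)) (J (S (\<sigma> (Suc n) - s) x))"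
proof -
  obtain m where m: "between m t"
    using between_exists assms(2) impulse_nonneg by (meson order_trans)
  have "Suc n \<le> m" using between_le_mono[OF between_impulse m assms(2)] .
  then show ?thesis
    using assms m between_impulse[of "Suc n"]
    by (simp add: propagator_eq_jump_flow[of n s m] propagator_eq_jump_flow[of "Suc n" _ m]
        upt_conv_Cons[of "Suc n"] del: upt_Suc)
qed

text \<open>
  Started at a grid point \<open>\<sigma> k\<close> and stopped before the next one, the propagator is the semigroup and counts no
  impulse, so the growth condition bounds \<open>S \<tau>\<close> by \<open>g \<tau>\<close> for every \<open>\<tau>\<close> below the length of some dwell
  interval. The supremum of these values is finite.
\<close>

lemma growth_condition_semigroup_bound:
  assumes growth: "growth_condition S J \<sigma>"
  shows "\<exists>G. \<forall>k. \<forall>\<tau>\<ge>0. \<tau> < \<sigma> (Suc k) - \<sigma> k \<longrightarrow> norm (S \<tau>) \<le> G"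
proof -
  obtain g c\<^sub>0 \<mu> where c: "c\<^sub>0 > 0" "\<And>\<tau>. \<tau> \<ge> 0 \<Longrightarrow> g \<tau> \<ge> c\<^sub>0"
    and bound: "\<And>s t x. 0 \<le> s \<Longrightarrow> s \<le> t \<Longrightarrow>
           norm (U t s x) \<le> g (t - s) * \<mu> ^ impulse_count \<sigma> t s * norm x"
    and sup: "(SUP \<tau>\<in>{\<tau>. 0 \<le> \<tau> \<and> ereal \<tau> < max_dwell_time \<sigma>}. ereal (g \<tau>)) < \<infinity>"
    using growth unfolding growth_condition_def by blast
  define H where "H = (SUP \<tau>\<in>{\<tau>. 0 \<le> \<tau> \<and> ereal \<tau> < max_dwell_time \<sigma>}. ereal (g \<tau>))"
  show ?thesis
  proof (intro exI[of _ "real_of_ereal H"] allI impI)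
    fix k \<tau> assume \<tau>: "0 \<le> \<tau>" "\<tau> < \<sigma> (Suc k) - \<sigma> k"
    have "ereal \<tau> < ereal (\<sigma> (Suc k) - \<sigma> k)" using \<tau> by simp
    also have "\<dots> \<le> max_dwell_time \<sigma>"
      unfolding max_dwell_time_def by (rule SUP_upper) simp
    finally have "ereal (g \<tau>) \<le> H"
      unfolding H_def using \<tau> by (intro SUP_upper) simp
    then have g: "g \<tau> \<le> real_of_ereal H"
      using sup unfolding H_def[symmetric] by (cases H) auto
    have b: "between k (\<sigma> k + \<tau>)" using \<tau> by (simp add: between_def)
    have "norm (S \<tau> x) \<le> g \<tau> * norm x" for x
      using bound[of "\<sigma> k" "\<sigma> k + \<tau>" x] \<tau> impulse_nonneg
      by (simp add: propagator_before_impulse[OF between_impulse b] impulse_count_eq[OF between_impulse b])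
    then have "norm (S \<tau>) \<le> g \<tau>"
      using c \<tau> by (intro norm_blinfun_bound) (auto intro: order_trans less_imp_le)
    then show "norm (S \<tau>) \<le> real_of_ereal H" using g by simp
  qed
qed

end

locale impulsive_system = impulse_grid S J \<sigma>
  for S :: "real \<Rightarrow> 'a \<Rightarrow>\<^sub>L 'a::real_normed_vector"
    and J :: "'a \<Rightarrow>\<^sub>L 'a"
    and \<sigma> :: "nat \<Rightarrow> real" +
  fixes G :: real
  assumes semigroup: "C0_semigroup S"
    and semigroup_bound: "\<And>k \<tau>. 0 \<le> \<tau> \<Longrightarrow> \<tau> < \<sigma> (Suc k) - \<sigma> k \<Longrightarrow> norm (S \<tau>) \<le> G"
begin

lemma semigroup_continuous:
  "continuous_on {0..\<sigma> (Suc k) - \<sigma> k} (\<lambda>\<tau>. S \<tau> x)"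
  using semigroup semigroup_bound by (rule C0_semigroup_strongly_continuous)

lemma semigroup_add: "0 \<le> s \<Longrightarrow> 0 \<le> t \<Longrightarrow> S s (S t x) = S (s + t) x"
  using semigroup by (simp add: C0_semigroup_def)

lemma eventually_between_at_left:
  assumes "s < \<sigma> (Suc k)"
  shows "eventually (\<lambda>t. s < t \<and> between k t) (at_left (\<sigma> (Suc k)))"
  using assms by (intro eventually_at_leftI[of "max s (\<sigma> k)"]) (auto simp: between_def)

text \<open>
  \<open>propagator_left\<close> is defined by \<open>Lim\<close>, which has the intended meaning only if the limit exists.
  Existence is proved by induction on the number of impulses between \<open>s\<close> and \<open>\<sigma> k\<close>; the unfolding at the
  first impulse passes to the limit.
\<close>

lemma propagator_left_limits:
  assumes "between n s"
  shows propagator_left_first: "U_left (Suc n) s x = S (\<sigma> (Suc n) - s) x"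
    and propagator_left_step:
      "Suc n < k \<Longrightarrow> U_left k s x = U_left k (\<sigma> (Suc n)) (J (S (\<sigma> (Suc n) - s) x))"
    and propagator_left_tendsto:
      "n < k \<Longrightarrow> ((\<lambda>t. U t s x) \<longlongrightarrow> U_left k s x) (at_left (\<sigma> k))"
proof -
  have first: "((\<lambda>t. U t s x) \<longlongrightarrow> S (\<sigma> (Suc n) - s) x) (at_left (\<sigma> (Suc n)))"
    if ns: "between n s" for n s x
  proof -
    have "continuous_on {s..\<sigma> (Suc n)} (\<lambda>t. S (t - s) x)"
      using ns by (intro continuous_on_compose2[OF semigroup_continuous[of n]] continuous_intros)
        (auto simp: between_def)
    then have "((\<lambda>t. S (t - s) x) \<longlongrightarrow> S (\<sigma> (Suc n) - s) x) (at_left (\<sigma> (Suc n)))"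
      using ns by (intro continuous_on_Icc_at_leftD) (auto simp: between_def)
    moreover have "eventually (\<lambda>t. S (t - s) x = U t s x) (at_left (\<sigma> (Suc n)))"
    proof (rule eventually_mono[OF eventually_between_at_left])
      show "s < \<sigma> (Suc n)" using ns by (simp add: between_def)
    qed (use propagator_before_impulse[OF ns] in auto)
    ultimately show ?thesis by (rule Lim_transform_eventually)
  qed
  have step_ev: "eventually (\<lambda>t. U t (\<sigma> (Suc n)) (J (S (\<sigma> (Suc n) - s) x)) = U t s x) (at_left (\<sigma> k))"
    if "between n s" "Suc n < k" for n s x k
    using that by (intro eventually_at_leftI[of "\<sigma> (Suc n)"]) (auto simp: propagator_first_impulse)
  have ex: "\<exists>l. ((\<lambda>t. U t s x) \<longlongrightarrow> l) (at_left (\<sigma> (Suc n + j)))" if "between n s" for n s x j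
    using that
  proof (induction j arbitrary: n s x)
    case 0
    then show ?case using first[of n s x] by auto
  next
    case (Suc j)
    obtain l where "((\<lambda>t. U t (\<sigma> (Suc n)) (J (S (\<sigma> (Suc n) - s) x))) \<longlongrightarrow> l)
        (at_left (\<sigma> (Suc n + Suc j)))"
      using Suc.IH[OF between_impulse[of "Suc n"], of "J (S (\<sigma> (Suc n) - s) x)"] by auto
    then have "((\<lambda>t. U t s x) \<longlongrightarrow> l) (at_left (\<sigma> (Suc n + Suc j)))"
      using step_ev[OF Suc.prems, of "Suc n + Suc j" x] by (rule Lim_transform_eventually) simp
    then show ?case by blast
  qed
  have tendsto: "((\<lambda>t. U t s x) \<longlongrightarrow> U_left k s x) (at_left (\<sigma> k))"
    if ns: "between n s" and nk: "n < k" for n s k x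
  proof -
    obtain l where "((\<lambda>t. U t s x) \<longlongrightarrow> l) (at_left (\<sigma> k))"
      using ex[OF ns, of x "k - Suc n"] nk by auto
    then show ?thesis
      by (simp add: propagator_left_def tendsto_Lim)
  qed
  show "n < k \<Longrightarrow> ((\<lambda>t. U t s x) \<longlongrightarrow> U_left k s x) (at_left (\<sigma> k))"
    using assms by (rule tendsto)
  show "U_left (Suc n) s x = S (\<sigma> (Suc n) - s) x"
    using tendsto_unique[OF _ tendsto[OF assms] first[OF assms]] by simp
  assume k: "Suc n < k"
  have "((\<lambda>t. U t s x) \<longlongrightarrow> U_left k (\<sigma> (Suc n)) (J (S (\<sigma> (Suc n) - s) x))) (at_left (\<sigma> k))"
    using tendsto[OF between_impulse k] step_ev[OF assms k] by (rule Lim_transform_eventually)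
  then show "U_left k s x = U_left k (\<sigma> (Suc n)) (J (S (\<sigma> (Suc n) - s) x))"
    using tendsto_unique[OF _ tendsto[OF assms, of k x]] k by simp
qed

section \<open>Decay from a Lyapunov inequality over one dwell interval\<close>

text \<open>
  The common core of (ii) \<open>\<Longrightarrow>\<close> (i) and (iii) \<open>\<Longrightarrow>\<close> (i): by the upper bound, the amount
  \<open>norm y powr p\<close> that \<open>V\<close> loses at an impulse is at least the fraction \<open>1 / B\<close> of what remains.
\<close>

lemma exponential_decay_if_lyapunov_step:
  fixes V :: "real \<Rightarrow> 'a \<Rightarrow> real"
  assumes J: "J \<noteq> 0" and p: "p \<ge> 1" and c: "c > 0"
    and upper: "\<And>t x. t \<ge> 0 \<Longrightarrow> V t x \<le> c * norm x powr p"
    and nonneg: "\<And>t x. t \<ge> 0 \<Longrightarrow> 0 \<le> V t x"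
    and step: "\<And>n s x. between n s \<Longrightarrow>
      norm (S (\<sigma> (Suc n) - s) x) powr p + V (\<sigma> (Suc n)) (J (S (\<sigma> (Suc n) - s) x)) \<le> V s x"
  shows "\<exists>M \<rho>. M \<ge> 1 \<and> 0 < \<rho> \<and> \<rho> < 1 \<and>
    (\<forall>s t. 0 \<le> s \<and> s \<le> t \<longrightarrow> norm (U t s) \<le> M * \<rho> ^ impulse_count \<sigma> t s)"
proof -
  define B where "B = c * norm J powr p"
  define q where "q = B / (1 + B)"
  define K where "K = (G * norm J) powr p"
  have B: "B > 0" using c J by (simp add: B_def)
  have q: "0 < q" "q < 1" using B by (auto simp: q_def)
  have G: "0 \<le> G"
    by (rule order_trans[OF norm_ge_zero semigroup_bound[of 0 0]]) auto
  have contract: "V (\<sigma> (Suc n)) (J (S (\<sigma> (Suc n) - s) x)) \<le> q * V s x" if "between n s" for n s x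
  proof -
    define y where "y = S (\<sigma> (Suc n) - s) x"
    have "V (\<sigma> (Suc n)) (J y) \<le> c * norm (J y) powr p"
      by (intro upper impulse_nonneg)
    also have "\<dots> \<le> c * (norm J * norm y) powr p"
      using c p by (intro mult_left_mono powr_mono2 norm_blinfun) auto
    also have "\<dots> = B * norm y powr p" by (simp add: B_def powr_mult)
    finally have *: "V (\<sigma> (Suc n)) (J y) \<le> B * norm y powr p" .
    have "B * (norm y powr p + V (\<sigma> (Suc n)) (J y)) \<le> B * V s x"
      using step[OF that, of x] B by (intro mult_left_mono) (auto simp: y_def)
    then have "(1 + B) * V (\<sigma> (Suc n)) (J y) \<le> B * V s x"
      using * by (simp add: algebra_simps)
    then show ?thesis using B by (simp add: q_def y_def field_simps)
  qed
  \<comment> \<open>The index \<open>j\<close> counts the impulses beyond the first. With no impulse at all there is no estimate by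
    \<open>V\<close>, since \<open>V\<close> only sees the states before impulses.\<close>
  have after: "norm (U t s x) powr p \<le> K * q ^ j * V s x"
    if "between n s" "between (Suc n + j) t" for n s t j x
    using that
  proof (induction j arbitrary: n s x)
    case 0
    define y where "y = S (\<sigma> (Suc n) - s) x"
    have t: "\<sigma> (Suc n) \<le> t" "between (Suc n) t" using 0 by (auto simp: between_def)
    have "norm (U t s x) = norm (S (t - \<sigma> (Suc n)) (J y))"
      using t 0 by (simp add: propagator_first_impulse propagator_before_impulse[OF between_impulse] y_def)
    also have "\<dots> \<le> norm (S (t - \<sigma> (Suc n))) * norm (J y)" by (rule norm_blinfun)
    also have "\<dots> \<le> G * (norm J * norm y)"
      using t G by (intro mult_mono norm_blinfun semigroup_bound[of _ "Suc n"]) (auto simp: between_def)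
    finally have "norm (U t s x) powr p \<le> (G * norm J * norm y) powr p"
      using p by (intro powr_mono2) (auto simp: mult.assoc)
    also have "\<dots> = K * norm y powr p"
      using G by (simp add: K_def powr_mult)
    also have "norm y powr p \<le> V s x"
      using step[OF 0(1), of x] nonneg[OF impulse_nonneg, of "Suc n" "J y"] by (simp add: y_def)
    finally show ?case by (simp add: K_def mult_left_mono)
  next
    case (Suc j)
    define y where "y = S (\<sigma> (Suc n) - s) x"
    have "\<sigma> (Suc n) \<le> \<sigma> (Suc n + Suc j)" by simp
    also have "\<dots> \<le> t" using Suc.prems by (simp add: between_def)
    finally have "norm (U t s x) powr p = norm (U t (\<sigma> (Suc n)) (J y)) powr p"
      using Suc.prems by (simp add: propagator_first_impulse y_def)
    also have "\<dots> \<le> K * q ^ j * V (\<sigma> (Suc n)) (J y)"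
      using Suc.prems by (intro Suc.IH[of "Suc n"] between_impulse) auto
    also have "\<dots> \<le> K * q ^ j * (q * V s x)"
      using contract[OF Suc.prems(1), of x] q by (intro mult_left_mono) (auto simp: y_def K_def)
    finally show ?case by (simp add: mult_ac)
  qed
  \<comment> \<open>These constants come from taking \<open>p\<close>-th roots. \<open>C\<close> absorbs a factor \<open>1 / q\<close> because the first
    impulse brings no factor \<open>q\<close>, and \<open>G\<close> covers the case without impulses.\<close>
  define \<rho> where "\<rho> = q powr (1 / p)"
  define C where "C = (K * c / q) powr (1 / p)"
  define M where "M = max 1 (max G C)"
  have \<rho>: "0 < \<rho>" "\<rho> < 1"
    using q p powr_less_mono2[of "1 / p" q 1] by (auto simp: \<rho>_def)
  have "norm (U t s) \<le> M * \<rho> ^ impulse_count \<sigma> t s" if st: "0 \<le> s" "s \<le> t" for s t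
  proof -
    obtain n where n: "between n s" using between_exists st by blast
    obtain m where m: "between m t" using between_exists st by (meson order_trans)
    have "n \<le> m" using between_le_mono[OF n m] st by simp
    show ?thesis
    proof (cases "m = n")
      case True
      then have "norm (U t s) \<le> G"
        using n m st semigroup_bound[of "t - s" n] propagator_before_impulse[OF n, of t]
        by (simp add: between_def)
      then show ?thesis using True n m by (simp add: impulse_count_eq M_def)
    next
      case False
      then obtain j where j: "m = Suc n + j"
        using \<open>n \<le> m\<close> by (metis le_neq_implies_less less_imp_Suc_add add_Suc)
      have "norm (U t s x) \<le> M * \<rho> ^ Suc j * norm x" for x
      proof -
        have "norm (U t s x) powr p \<le> K * q ^ j * V s x"
          using after n m j by simp
        also have "\<dots> \<le> K * q ^ j * (c * norm x powr p)"
          using upper[OF st(1)] q by (intro mult_left_mono) (auto simp: K_def)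
        also have "\<dots> = K * c / q * q ^ Suc j * norm x powr p"
          using q by simp
        finally have "(norm (U t s x) powr p) powr (1 / p) \<le>
            (K * c / q * q ^ Suc j * norm x powr p) powr (1 / p)"
          using p by (intro powr_mono2) auto
        also have "\<dots> = C * (q ^ Suc j) powr (1 / p) * norm x"
          using p by (simp only: C_def powr_mult powr_powr) simp
        also have "(q ^ Suc j) powr (1 / p) = \<rho> ^ Suc j"
          using q by (simp add: \<rho>_def powr_power powr_realpow[symmetric] powr_powr del: power_Suc)
        also have "C * \<rho> ^ Suc j * norm x \<le> M * \<rho> ^ Suc j * norm x"
          using \<rho> by (intro mult_right_mono) (auto simp: M_def)
        finally show ?thesis using p by (simp add: powr_powr)
      qed
      then have "norm (U t s) \<le> M * \<rho> ^ Suc j"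
        using \<rho> by (intro norm_blinfun_bound) (auto simp: M_def)
      then show ?thesis using n m j by (simp add: impulse_count_eq)
    qed
  qed
  then show ?thesis using \<rho> by (intro exI[of _ M] exI[of _ \<rho>]) (auto simp: M_def)
qed

text \<open>
  Along the flow started in \<open>x\<close> at time \<open>s\<close>, the Dini derivative of \<open>V\<close> is that of the real function
  \<open>v\<close> below, so \<open>v\<close> does not increase before the impulse at \<open>T\<close>. As \<open>V\<close> is Lipschitz uniformly in time,
  the left limit of \<open>v\<close> at \<open>T\<close> is the left limit of \<open>V\<close> at the fixed state \<open>z T\<close>, to which the jump
  condition applies.
\<close>

lemma lyapunov_functional_step:
  assumes V: "lyapunov_functional S J \<sigma> V p c" and n: "between n s"
  shows "norm (S (\<sigma> (Suc n) - s) x) powr p + V (\<sigma> (Suc n)) (J (S (\<sigma> (Suc n) - s) x)) \<le> V s x"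
proof -
  define T where "T = \<sigma> (Suc n)"
  define z where "z t = S (t - s) x" for t
  define v where "v t = V t (z t)" for t
  have s: "0 \<le> s" "s < T" "\<sigma> n \<le> s" using n between_nonneg by (auto simp: between_def T_def)
  have lip: "lipschitz_on_bounded_sets V" and prc: "piecewise_right_continuous \<sigma> V"
    using V by (auto simp: lyapunov_functional_def)
  have z_cont: "continuous_on {s..T} z"
    unfolding z_def using s
    by (intro continuous_on_compose2[OF semigroup_continuous[of n]] continuous_intros) (auto simp: T_def)
  have v_cont: "continuous_on {s..<T} v"
    unfolding continuous_on_def
  proof
    fix t assume t: "t \<in> {s..<T}"
    let ?F = "at t within {s..<T}"
    have "(z \<longlongrightarrow> z t) ?F"
      using z_cont t by (auto simp: continuous_on_def intro: tendsto_within_subset[where S = "{s..T}"])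
    moreover have "eventually (\<lambda>t. t \<ge> 0) ?F"
      using s by (auto simp: eventually_at_filter)
    ultimately have "((\<lambda>r. V r (z r) - V r (z t)) \<longlongrightarrow> 0) ?F"
      using lip by (intro lipschitz_on_bounded_sets_continuous)
    moreover have "((\<lambda>r. V r (z t)) \<longlongrightarrow> V t (z t)) ?F"
    proof -
      have "continuous_on {s..<T} (\<lambda>r. V r (z t))"
        by (rule continuous_on_subset[of "{\<sigma> n..<\<sigma> (Suc n)}"])
          (use prc s in \<open>auto simp: piecewise_right_continuous_def T_def\<close>)
      then show ?thesis using t by (simp add: continuous_on_def)
    qed
    ultimately have "((\<lambda>r. (V r (z r) - V r (z t)) + V r (z t)) \<longlongrightarrow> 0 + V t (z t)) ?F"
      by (rule tendsto_add)
    then show "(v \<longlongrightarrow> v t) ?F" by (simp add: v_def[abs_def])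
  qed
  have decr: "v t \<le> v s" if "s \<le> t" "t < T" for t
  proof (rule nonincreasing_if_lower_dini_nonpos[where v = v])
    show "continuous_on {s..t} v"
      by (rule continuous_on_subset[OF v_cont]) (use that in auto)
    fix r assume r: "s \<le> r" "r < t"
    have "Liminf (at_right 0) (\<lambda>h. ereal ((v (r + h) - v r) / h)) = dini_derivative S V r (z r)"
      unfolding dini_derivative_def
    proof (rule Liminf_eq, rule eventually_at_rightI[of 0 1])
      fix h :: real assume "h \<in> {0<..<1}"
      then have "S h (z r) = z (r + h)"
        using r by (simp add: z_def semigroup_add algebra_simps)
      then show "ereal ((v (r + h) - v r) / h) = ereal ((V (r + h) (S h (z r)) - V r (z r)) / h)"
        by (simp add: v_def)
    qed simp
    also have "\<dots> \<le> 0"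
      using V r s by (simp add: lyapunov_functional_def)
    finally show "Liminf (at_right 0) (\<lambda>h. ereal ((v (r + h) - v r) / h)) \<le> 0" .
  qed (use that in auto)
  have ev: "eventually (\<lambda>t. s < t \<and> t < T) (at_left T)"
    using s by (intro eventually_at_leftI[of s]) auto
  have T: "T \<in> impulse_times \<sigma>" by (auto simp: impulse_times_def T_def)
  then obtain l where l: "((\<lambda>t. V t (z T)) \<longlongrightarrow> l) (at_left T)"
    using prc unfolding piecewise_right_continuous_def by blast
  have "(z \<longlongrightarrow> z T) (at_left T)"
    using continuous_on_Icc_at_leftD[OF z_cont] s by auto
  then have "((\<lambda>t. V t (z t) - V t (z T)) \<longlongrightarrow> 0) (at_left T)"
    using lip s by (intro lipschitz_on_bounded_sets_continuous eventually_mono[OF ev]) auto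
  from tendsto_add[OF this l] have "(v \<longlongrightarrow> l) (at_left T)" by (simp add: v_def[abs_def])
  moreover have "eventually (\<lambda>t. v t \<le> v s) (at_left T)"
    using ev by eventually_elim (simp add: decr)
  ultimately have "l \<le> v s" by (rule tendsto_upperbound) simp
  moreover have "V T (J (z T)) - l \<le> - (norm (z T) powr p)"
    using V T tendsto_Lim[OF _ l] by (auto simp: lyapunov_functional_def)
  moreover have "v s = V s x"
    using semigroup by (simp add: v_def z_def C0_semigroup_def)
  ultimately show ?thesis by (simp add: z_def T_def)
qed

section \<open>The functional summing the states before the jumps\<close>

definition jump_energy :: "real \<Rightarrow> real \<Rightarrow> 'a \<Rightarrow> real" where
  "jump_energy p t x = (\<Sum>\<^sub>\<infinity>k\<in>later t. norm (U_left k t x) powr p)"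

lemma jump_energy_nonneg: "0 \<le> jump_energy p t x"
  by (simp add: jump_energy_def infsum_nonneg)

text \<open>
  The summand at the first impulse is split off; the other summands belong to the trajectory that restarts
  right after that impulse.
\<close>

lemma jump_energy_step:
  assumes n: "between n s"
    and summable: "\<And>s x. 0 \<le> s \<Longrightarrow> (\<lambda>k. norm (U_left k s x) powr p) summable_on later s"
  shows "jump_energy p s x =
    norm (S (\<sigma> (Suc n) - s) x) powr p + jump_energy p (\<sigma> (Suc n)) (J (S (\<sigma> (Suc n) - s) x))"
proof -
  define y where "y = J (S (\<sigma> (Suc n) - s) x)"
  have later: "later (\<sigma> (Suc n)) = {Suc (Suc n)..}"
    using between_impulse by (rule later_eq)
  have eq: "norm (U_left k s x) powr p = norm (U_left k (\<sigma> (Suc n)) y) powr p"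
    if "k \<in> {Suc (Suc n)..}" for k
    using that n by (simp add: propagator_left_step y_def)
  have "(\<lambda>k. norm (U_left k (\<sigma> (Suc n)) y) powr p) summable_on {Suc (Suc n)..}"
    using summable[OF impulse_nonneg, of "Suc n" y] unfolding later .
  then have "(\<lambda>k. norm (U_left k s x) powr p) summable_on {Suc (Suc n)..}"
    by (rule summable_on_cong[THEN iffD2, rotated]) (rule eq)
  moreover have "later s = insert (Suc n) {Suc (Suc n)..}"
    unfolding later_eq[OF n] by auto
  moreover have "(\<Sum>\<^sub>\<infinity>k\<in>{Suc (Suc n)..}. norm (U_left k s x) powr p) =
      (\<Sum>\<^sub>\<infinity>k\<in>{Suc (Suc n)..}. norm (U_left k (\<sigma> (Suc n)) y) powr p)"
    using eq by (rule infsum_cong)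
  ultimately show ?thesis
    unfolding jump_energy_def later
    by (simp add: infsum_insert propagator_left_first[OF n] y_def[symmetric])
qed

text \<open>
  The exponent is smaller by one than the number of impulses up to \<open>\<sigma> k\<close>, as the impulse at \<open>\<sigma> k\<close> has not
  yet happened.
\<close>

lemma propagator_left_diff_bound:
  assumes decay: "\<And>s t. 0 \<le> s \<Longrightarrow> s \<le> t \<Longrightarrow> norm (U t s) \<le> M * \<rho> ^ impulse_count \<sigma> t s"
    and n: "between n s" and "n < k"
  shows "norm (U_left k s x - U_left k s y) \<le> M * \<rho> ^ (k - Suc n) * norm (x - y)"
proof (rule tendsto_upperbound)
  show "((\<lambda>t. norm (U t s x - U t s y)) \<longlongrightarrow> norm (U_left k s x - U_left k s y)) (at_left (\<sigma> k))"
    by (intro tendsto_intros propagator_left_tendsto[OF n \<open>n < k\<close>])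
  obtain m where m: "k = Suc m" using \<open>n < k\<close> by (cases k) auto
  have "s < \<sigma> (Suc m)" using impulse_greater_iff[OF n] \<open>n < k\<close> m by simp
  from eventually_between_at_left[OF this]
  show "eventually (\<lambda>t. norm (U t s x - U t s y) \<le> M * \<rho> ^ (k - Suc n) * norm (x - y)) (at_left (\<sigma> k))"
    unfolding m
  proof eventually_elim
    case (elim t)
    have "norm (U t s x - U t s y) = norm (U t s (x - y))" by (simp add: blinfun.diff_right)
    also have "\<dots> \<le> norm (U t s) * norm (x - y)" by (rule norm_blinfun)
    also have "\<dots> \<le> M * \<rho> ^ impulse_count \<sigma> t s * norm (x - y)"
      using elim between_nonneg[OF n] by (intro mult_right_mono decay) auto
    finally show ?case using elim by (simp add: impulse_count_eq[OF n, of m])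
  qed
qed simp

context
  fixes M \<rho> p :: real
  assumes M: "M \<ge> 1" and \<rho>: "0 < \<rho>" "\<rho> < 1" and p: "p \<ge> 1"
    and decay: "\<And>s t. 0 \<le> s \<Longrightarrow> s \<le> t \<Longrightarrow> norm (U t s) \<le> M * \<rho> ^ impulse_count \<sigma> t s"
begin

lemma propagator_left_bound:
  assumes "between n s" "n < k"
  shows "norm (U_left k s x) \<le> M * \<rho> ^ (k - Suc n) * norm x"
proof -
  have "U_left k s 0 = 0"
    using tendsto_unique[OF _ propagator_left_tendsto[OF assms, of 0]] by simp
  then show ?thesis
    using propagator_left_diff_bound[OF decay assms, where x = x and y = 0] by simp
qed

text \<open>
  The exponent \<open>p \<ge> 1\<close> on the powers of \<open>\<rho> < 1\<close> is dropped, so that one geometric series serves the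
  upper bound and the Lipschitz estimate alike.
\<close>

lemma propagator_left_powr_bound:
  assumes "between n s" "k \<in> {Suc n..}"
  shows "norm (U_left k s x) powr p \<le> M powr p * norm x powr p * \<rho> ^ (k - Suc n)"
proof -
  have "norm (U_left k s x) powr p \<le> (M * \<rho> ^ (k - Suc n) * norm x) powr p"
    using propagator_left_bound[OF assms(1)] assms p by (intro powr_mono2) auto
  also have "\<dots> = M powr p * norm x powr p * (\<rho> ^ (k - Suc n)) powr p"
    using M \<rho> by (simp add: powr_mult)
  also have "(\<rho> ^ (k - Suc n)) powr p \<le> (\<rho> ^ (k - Suc n)) powr 1"
    using \<rho> p by (intro powr_mono') (auto simp: power_le_one)
  finally show ?thesis using \<rho> by (simp add: mult_left_mono)
qed

lemma geometric_has_sum_cmult: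
  "((\<lambda>k. C * \<rho> ^ (k - n)) has_sum C / (1 - \<rho>)) {n..}"
  using has_sum_cmult_right[OF geometric_has_sum_shifted[OF \<rho>, of n], of C] by simp

lemma jump_energy_summable_between:
  assumes "between n s"
  shows "(\<lambda>k. norm (U_left k s x) powr p) summable_on {Suc n..}"
proof (rule summable_on_comparison_test)
  show "(\<lambda>k. M powr p * norm x powr p * \<rho> ^ (k - Suc n)) summable_on {Suc n..}"
    using geometric_has_sum_cmult by (rule has_sum_imp_summable)
qed (use propagator_left_powr_bound[OF assms] in auto)

lemma jump_energy_summable:
  assumes "0 \<le> s"
  shows "(\<lambda>k. norm (U_left k s x) powr p) summable_on later s"
  using assms jump_energy_summable_between by (metis between_exists later_eq)

lemma jump_energy_upper:
  assumes "0 \<le> s"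
  shows "jump_energy p s x \<le> M powr p / (1 - \<rho>) * norm x powr p"
proof -
  obtain n where n: "between n s" using between_exists assms by blast
  have "jump_energy p s x \<le> M powr p * norm x powr p / (1 - \<rho>)"
    unfolding jump_energy_def later_eq[OF n]
    by (rule has_sum_mono[OF has_sum_infsum geometric_has_sum_cmult])
      (use jump_energy_summable_between[OF n] propagator_left_powr_bound[OF n] in auto)
  then show ?thesis by simp
qed

text \<open>
  On a ball of radius \<open>r\<close> all states before impulses stay below \<open>M * r\<close>, so each summand is Lipschitz in the
  corresponding state, and the states depend on \<open>x\<close> with geometrically decaying Lipschitz constants.
\<close>

lemma jump_energy_lipschitz: "lipschitz_on_bounded_sets (jump_energy p)"
  unfolding lipschitz_on_bounded_sets_def
proof (intro allI impI)
  fix r :: real assume r: "r > 0"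
  define L where "L = p * (M * r) powr (p - 1) * M / (1 - \<rho>)"
  have "L > 0" using r M \<rho> p by (simp add: L_def)
  have one_sided: "jump_energy p t x \<le> jump_energy p t y + L * norm (x - y)"
    if x: "norm x < r" and y: "norm y < r" and t: "t \<ge> 0" for x y t
  proof -
    obtain n where n: "between n t" using between_exists t by blast
    define C where "C = p * (M * r) powr (p - 1) * (M * norm (x - y))"
    have le: "norm (U_left k t x) powr p \<le> norm (U_left k t y) powr p + C * \<rho> ^ (k - Suc n)"
      if k: "k \<in> {Suc n..}" for k
    proof -
      have le_R: "norm (U_left k t z) \<le> M * r" if "norm z < r" for z
      proof -
        have "norm (U_left k t z) \<le> M * \<rho> ^ (k - Suc n) * norm z"
          using k by (intro propagator_left_bound n) auto
        also have "\<dots> \<le> M * 1 * r"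
          using M \<rho> that by (intro mult_mono power_le_one) auto
        finally show ?thesis by simp
      qed
      have "norm (U_left k t x) powr p - norm (U_left k t y) powr p
          \<le> p * (M * r) powr (p - 1) * \<bar>norm (U_left k t x) - norm (U_left k t y)\<bar>"
        using abs_diff_powr_le[OF p, of "norm (U_left k t x)" "norm (U_left k t y)" "M * r"] le_R x y
        by simp
      also have "\<dots> \<le> p * (M * r) powr (p - 1) * (M * \<rho> ^ (k - Suc n) * norm (x - y))"
        using k p by (intro mult_left_mono order_trans[OF norm_triangle_ineq3]
            propagator_left_diff_bound[OF decay n]) auto
      finally show ?thesis by (simp add: C_def mult_ac)
    qed
    have "jump_energy p t x \<le> jump_energy p t y + C / (1 - \<rho>)"
      unfolding jump_energy_def later_eq[OF n]
      by (rule has_sum_mono[OF has_sum_infsum has_sum_add[OF has_sum_infsum geometric_has_sum_cmult]])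
        (use jump_energy_summable_between[OF n] le in auto)
    then show ?thesis by (simp add: C_def L_def mult_ac)
  qed
  show "\<exists>L>0. \<forall>x y t. norm x < r \<and> norm y < r \<and> t \<ge> 0 \<longrightarrow>
      \<bar>jump_energy p t x - jump_energy p t y\<bar> \<le> L * norm (x - y)"
  proof (intro exI[of _ L] conjI allI impI \<open>L > 0\<close>)
    fix x y :: 'a and t :: real assume "norm x < r \<and> norm y < r \<and> t \<ge> 0"
    then show "\<bar>jump_energy p t x - jump_energy p t y\<bar> \<le> L * norm (x - y)"
      using one_sided[of x y t] one_sided[of y x t] by (simp add: abs_le_iff norm_minus_commute)
  qed
qed

text \<open>
  On the dwell interval before \<open>\<sigma> (Suc k)\<close>, time and state enter the functional only through
  \<open>S (\<sigma> (Suc k) - t) x\<close>, via the continuous function \<open>F k\<close> below. The semigroup law makes this state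
  invariant along the flow, so the Dini derivative vanishes and the jump condition holds with equality.
\<close>

lemma jump_energy_lyapunov:
  "lyapunov_functional S J \<sigma> (jump_energy p) p (M powr p / (1 - \<rho>))"
proof -
  note step = jump_energy_step[OF _ jump_energy_summable]
  define F where "F k y = norm y powr p + jump_energy p (\<sigma> (Suc k)) (J y)" for k y
  have F: "jump_energy p t x = F k (S (\<sigma> (Suc k) - t) x)" if "between k t" for k t x
    using step[OF that] by (simp add: F_def)
  have energy_cont: "continuous_on UNIV (jump_energy p t)" if "t \<ge> 0" for t
    unfolding continuous_on_def
  proof
    fix x :: 'a
    have "((\<lambda>y. jump_energy p t y - jump_energy p t x) \<longlongrightarrow> 0) (at x)"
      using lipschitz_on_bounded_sets_continuous[OF jump_energy_lipschitz, of "\<lambda>y. y" x "at x" "\<lambda>_. t"]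
        that by simp
    then show "(jump_energy p t \<longlongrightarrow> jump_energy p t x) (at x)"
      by (simp add: LIM_zero_iff)
  qed
  have F_cont: "continuous_on UNIV (F k)" for k
    unfolding F_def using p
    by (intro continuous_intros continuous_on_powr' continuous_on_compose2[OF energy_cont[OF impulse_nonneg]])
      auto
  have path_cont: "continuous_on {\<sigma> k..\<sigma> (Suc k)} (\<lambda>t. F k (S (\<sigma> (Suc k) - t) x))" for k x
    by (intro continuous_on_compose2[OF F_cont] continuous_on_compose2[OF semigroup_continuous[of k]]
        continuous_intros) auto
  have left: "((\<lambda>t. jump_energy p t x) \<longlongrightarrow> F k x) (at_left (\<sigma> (Suc k)))" for k x
  proof (rule Lim_transform_eventually)
    have "((\<lambda>t. F k (S (\<sigma> (Suc k) - t) x)) \<longlongrightarrow> F k (S (\<sigma> (Suc k) - \<sigma> (Suc k)) x)) (at_left (\<sigma> (Suc k)))"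
      by (intro continuous_on_Icc_at_leftD[OF path_cont]) simp
    then show "((\<lambda>t. F k (S (\<sigma> (Suc k) - t) x)) \<longlongrightarrow> F k x) (at_left (\<sigma> (Suc k)))"
      using semigroup by (simp add: C0_semigroup_def)
    show "eventually (\<lambda>t. F k (S (\<sigma> (Suc k) - t) x) = jump_energy p t x) (at_left (\<sigma> (Suc k)))"
      using eventually_between_at_left[of "\<sigma> k" k] by (auto simp: F elim!: eventually_mono)
  qed
  have "piecewise_right_continuous \<sigma> (jump_energy p)"
    unfolding piecewise_right_continuous_def
  proof (intro allI conjI ballI)
    fix x k
    have "continuous_on {\<sigma> k..<\<sigma> (Suc k)} (\<lambda>t. F k (S (\<sigma> (Suc k) - t) x))"
      using path_cont by (rule continuous_on_subset) auto
    then show "continuous_on {\<sigma> k..<\<sigma> (Suc k)} (\<lambda>t. jump_energy p t x)"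
      by (rule continuous_on_eq) (simp add: F between_def)
  next
    fix x \<tau> assume "\<tau> \<in> impulse_times \<sigma>"
    then obtain k where "\<tau> = \<sigma> (Suc k)"
      by (auto simp: impulse_times_def) (metis Suc_le_D One_nat_def)
    then show "\<exists>l. ((\<lambda>t. jump_energy p t x) \<longlongrightarrow> l) (at_left \<tau>)" using left by blast
  qed
  moreover have "dini_derivative S (jump_energy p) t x \<le> 0" if "t \<ge> 0" for t x
  proof -
    obtain n where n: "between n t" using between_exists \<open>t \<ge> 0\<close> by blast
    have "Liminf (at_right 0) (\<lambda>h. ereal ((jump_energy p (t + h) (S h x) - jump_energy p t x) / h))
        = Liminf (at_right 0) (\<lambda>h::real. 0)"
    proof (rule Liminf_eq, rule eventually_at_rightI[of 0 "\<sigma> (Suc n) - t"])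
      fix h assume h: "h \<in> {0<..<\<sigma> (Suc n) - t}"
      then have "between n (t + h)" using n by (auto simp: between_def)
      then have "jump_energy p (t + h) (S h x) = jump_energy p t x"
        using h n by (simp add: F semigroup_add algebra_simps)
      then show "ereal ((jump_energy p (t + h) (S h x) - jump_energy p t x) / h) = 0"
        by (simp add: zero_ereal_def)
    qed (use n in \<open>auto simp: between_def\<close>)
    then show ?thesis by (simp add: dini_derivative_def Liminf_const)
  qed
  moreover have "jump_energy p t (J x) - Lim (at_left t) (\<lambda>\<tau>. jump_energy p \<tau> x) \<le> - (norm x powr p)"
    if t: "t \<in> impulse_times \<sigma>" for t x
  proof -
    obtain k where "t = \<sigma> (Suc k)"
      using t by (auto simp: impulse_times_def) (metis Suc_le_D One_nat_def)
    then show ?thesis using tendsto_Lim[OF _ left, of k x] by (simp add: F_def)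
  qed
  ultimately show ?thesis
    using jump_energy_upper
    by (simp add: lyapunov_functional_def jump_energy_nonneg jump_energy_lipschitz)
qed

end

end

section \<open>Equivalence of exponential decay, summability and Lyapunov functionals\<close>

theorem theorem4p2:
  fixes S :: "real \<Rightarrow> 'a \<Rightarrow>\<^sub>L 'a::banach"
    and D :: "'a set" and A :: "'a \<Rightarrow> 'a"
    and J :: "'a \<Rightarrow>\<^sub>L 'a"
    and \<sigma> :: "nat \<Rightarrow> real"
  assumes "generates D A S"
    and "J \<noteq> 0"
    and "blinfun_apply J ` D \<subseteq> D"
    and "impulse_sequence \<sigma>"
    and "growth_condition S J \<sigma>"
  defines "stmt_i \<equiv>
      (\<exists>M \<rho>. M \<ge> 1 \<and> 0 < \<rho> \<and> \<rho> < 1 \<and>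
         (\<forall>s t. 0 \<le> s \<and> s \<le> t \<longrightarrow>
            norm (propagator S J \<sigma> t s) \<le> M * \<rho> ^ impulse_count \<sigma> t s))"
    and "stmt_ii \<equiv>
      (\<exists>p b. p \<ge> 1 \<and> b > 0 \<and>
         (\<forall>s\<ge>0. \<forall>x.
            (\<lambda>k. norm (propagator_left S J \<sigma> (\<sigma> k) s x) powr p) summable_on {k. k \<ge> 1 \<and> \<sigma> k > s} \<and>
            (\<Sum>\<^sub>\<infinity>k\<in>{k. k \<ge> 1 \<and> \<sigma> k > s}. norm (propagator_left S J \<sigma> (\<sigma> k) s x) powr p)
              \<le> b powr p * norm x powr p))"
    and "stmt_iii \<equiv>
      (\<exists>V p c. p \<ge> 1 \<and> c > 0 \<and> lyapunov_functional S J \<sigma> V p c)"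
  shows "(stmt_i \<longleftrightarrow> stmt_ii) \<and> (stmt_ii \<longleftrightarrow> stmt_iii) \<and>
    (stmt_i \<longrightarrow>
      (\<forall>p\<ge>1.
         (\<forall>t\<ge>0. \<forall>x.
            (\<lambda>k. norm (propagator_left S J \<sigma> (\<sigma> k) t x) powr p) summable_on {k. k \<ge> 1 \<and> \<sigma> k > t}) \<and>
         (\<exists>c>0. lyapunov_functional S J \<sigma>
            (\<lambda>t x. \<Sum>\<^sub>\<infinity>k\<in>{k. k \<ge> 1 \<and> \<sigma> k > t}. norm (propagator_left S J \<sigma> (\<sigma> k) t x) powr p) p c)))"
proof -
  interpret impulse_grid S J \<sigma> by unfold_locales fact
  obtain G where G: "\<And>k \<tau>. 0 \<le> \<tau> \<Longrightarrow> \<tau> < \<sigma> (Suc k) - \<sigma> k \<Longrightarrow> norm (S \<tau>) \<le> G"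
    using growth_condition_semigroup_bound[OF \<open>growth_condition S J \<sigma>\<close>] by auto
  interpret impulsive_system S J \<sigma> G
    using \<open>generates D A S\<close> G by unfold_locales (auto simp: generates_def)
  have i_summable: "(\<lambda>k. norm (U_left k t x) powr p) summable_on later t"
    and i_lyapunov: "\<exists>c>0. lyapunov_functional S J \<sigma> (jump_energy p) p c"
    if i: stmt_i and p: "p \<ge> 1" and "t \<ge> 0" for p t x
  proof -
    obtain M \<rho> where M: "M \<ge> 1" "0 < \<rho>" "\<rho> < 1"
      and decay: "\<And>s t. 0 \<le> s \<Longrightarrow> s \<le> t \<Longrightarrow> norm (U t s) \<le> M * \<rho> ^ impulse_count \<sigma> t s"
      using i unfolding stmt_i_def by blast
    show "(\<lambda>k. norm (U_left k t x) powr p) summable_on later t"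
      using jump_energy_summable[OF M p decay \<open>t \<ge> 0\<close>] .
    have "M powr p / (1 - \<rho>) > 0" using M by simp
    then show "\<exists>c>0. lyapunov_functional S J \<sigma> (jump_energy p) p c"
      using jump_energy_lyapunov[OF M p decay] by blast
  qed
  have "stmt_ii" if i: stmt_i
  proof -
    obtain c where c: "c > 0" and V: "lyapunov_functional S J \<sigma> (jump_energy 1) 1 c"
      using i_lyapunov[OF i order_refl order_refl] by blast
    have "jump_energy 1 t x \<le> c powr 1 * norm x powr 1" if "t \<ge> 0" for t x
      using V c that by (simp add: lyapunov_functional_def)
    then show stmt_ii
      unfolding stmt_ii_def using i_summable[OF i order_refl] c
      by (intro exI[of _ 1] exI[of _ c]) (simp add: jump_energy_def)
  qed
  moreover have "stmt_i" if stmt_ii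
  proof -
    obtain p b where p: "p \<ge> 1" "b > 0"
      and ii: "\<forall>s\<ge>0. \<forall>x. (\<lambda>k. norm (U_left k s x) powr p) summable_on later s \<and>
        jump_energy p s x \<le> b powr p * norm x powr p"
      using \<open>stmt_ii\<close> unfolding stmt_ii_def jump_energy_def by blast
    then have summable: "\<And>s x. s \<ge> 0 \<Longrightarrow> (\<lambda>k. norm (U_left k s x) powr p) summable_on later s"
      and bound: "\<And>s x. s \<ge> 0 \<Longrightarrow> jump_energy p s x \<le> b powr p * norm x powr p"
      by blast+
    have "b powr p > 0" using p by simp
    then show stmt_i
      unfolding stmt_i_def
      by (intro exponential_decay_if_lyapunov_step[of p "b powr p" "jump_energy p"])
        (use \<open>J \<noteq> 0\<close> p bound jump_energy_nonneg jump_energy_step[OF _ summable] in auto)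
  qed
  moreover have "stmt_i" if stmt_iii
  proof -
    obtain V p c where p: "p \<ge> 1" "c > 0" and V: "lyapunov_functional S J \<sigma> V p c"
      using \<open>stmt_iii\<close> unfolding stmt_iii_def by blast
    show stmt_i
      unfolding stmt_i_def
      by (intro exponential_decay_if_lyapunov_step[of p c V] lyapunov_functional_step[OF V])
        (use \<open>J \<noteq> 0\<close> p V in \<open>auto simp: lyapunov_functional_def\<close>)
  qed
  moreover have "stmt_iii" if stmt_i
    unfolding stmt_iii_def using i_lyapunov[OF that order_refl order_refl] by blast
  ultimately show ?thesis
    using i_summable i_lyapunov[OF _ _ order_refl] unfolding jump_energy_def by blast
qed

end
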